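(* Let $n \ge 1$, let $N = \{0,\dots,2n-1\}$, and let $G = (N, w)$ be a closed integer octagonal graph. Define $G_{\mathrm T} = (N, w_{\mathrm T})$ by, for all $i,j \in N$, \[ w_{\mathrm T}(i,j) := \min\Bigl\{ w(i,j),\ \Bigl\lfloor \tfrac{w(i,\bar\imath)}{2}\Bigr\rfloor + \Bigl\lfloor \tfrac{w(\bar\jmath,j)}{2}\Bigr\rfloor \Bigr\}. \] If $G_{\mathrm T}$ is an octagonal graph, then $G_{\mathrm T} = \mathrm{T\text{-}closure}(G)$.
   Context: Weights lie in $\mathbb{Q}_\infty = \mathbb{Q}\cup\{+\infty\}$ with $d<+\infty$ for all $d\in\mathbb{Q}$; $\lfloor +\infty/2\rfloor = +\infty$ and $+\infty + d = +\infty$. A graph on a finite node set $N$ is a pair $(N,w)$ with $w : N\times N \to \mathbb{Q}_\infty$; $(a,b)$ is an arc if $w(a,b)<+\infty$. A path is a finite nonempty sequence of nodes consecutive pairs of which are arcs; its weight is the sum of the arc weights. A graph is consistent if it has no cycle of negative weight (equivalently the system $\{a - b \le w(a,b)\}$ is satisfiable over $\mathbb{Q}$). For graphs on the same node set, $(N,w_1) \unlhd (N,w_2)$ iff $w_1(a,b)\le w_2(a,b)$ for all $a,b$. A consistent graph is closed if $w(a,a)=0$ for all $a$ and $w(a,b)\le w(a,c)+w(c,b)$ for all $a,b,c$. For $i \in N=\{0,\dots,2n-1\}$, $\bar\imath = i+1$ if $i$ is even and $\bar\imath = i-1$ if $i$ is odd. An octagonal graph is a consistent graph $(N,w)$ with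 $w(i,j) = w(\bar\jmath,\bar\imath)$ for all $i,j\in N$. It is an integer octagonal graph if moreover all weights lie in $\mathbb{Z}\cup\{+\infty\}$. An octagonal graph is strongly closed if it is closed and $2w(i,j) \le w(i,\bar\imath) + w(\bar\jmath,j)$ for all $i,j$. It is tightly closed if it is a strongly closed integer octagonal graph and $w(i,\bar\imath)$ is even for every $i$ (with $+\infty$ counted as allowed). The tight closure $\mathrm{T\text{-}closure}(G)$ is the least upper bound (pointwise maximum of weight functions) of the set of all tightly closed octagonal graphs $G' \unlhd G$, in the lattice of octagonal graphs augmented with a bottom element $\bot$ (inconsistency); the least upper bound of the empty set is $\bot$. *)

theory Defs
  imports Complex_Main "HOL-Library.FuncSet" "HOL-Algebra.Lattice"
begin

datatype qinf = Fin rat | PInf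

instantiation qinf :: linorder
begin

fun less_eq_qinf :: "qinf \<Rightarrow> qinf \<Rightarrow> bool" where
  "x \<le> PInf \<longleftrightarrow> True"
| "PInf \<le> Fin b \<longleftrightarrow> False"
| "Fin a \<le> Fin b \<longleftrightarrow> a \<le> b"

definition less_qinf :: "qinf \<Rightarrow> qinf \<Rightarrow> bool" where
  "x < y \<longleftrightarrow> x \<le> y \<and> \<not> y \<le> x" for x y :: qinf

instance
proof
  fix x y z :: qinf
  show "x < y \<longleftrightarrow> x \<le> y \<and> \<not> y \<le> x" by (rule less_qinf_def)
  show "x \<le> x" by (cases x) auto
  show "x \<le> y \<Longrightarrow> y \<le> z \<Longrightarrow> x \<le> z" by (cases x; cases y; cases z) auto
  show "x \<le> y \<Longrightarrow> y \<le> x \<Longrightarrow> x = y" by (cases x; cases y) auto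
  show "x \<le> y \<or> y \<le> x" by (cases x; cases y) auto
qed

end

instantiation qinf :: ordered_comm_monoid_add
begin

definition zero_qinf :: qinf where "0 = Fin 0"

fun plus_qinf :: "qinf \<Rightarrow> qinf \<Rightarrow> qinf" where
  "Fin a + Fin b = Fin (a + b)"
| "Fin a + PInf = PInf"
| "PInf + y = PInf"

instance
proof
  fix x y z :: qinf
  show "x + y + z = x + (y + z)" by (cases x; cases y; cases z) auto
  show "x + y = y + x" by (cases x; cases y) auto
  show "0 + x = x" by (cases x) (auto simp: zero_qinf_def)
  show "x \<le> y \<Longrightarrow> z + x \<le> z + y" by (cases x; cases y; cases z) auto
qed

end

fun floor_half :: "qinf \<Rightarrow> qinf" where
  "floor_half (Fin q) = Fin (of_int \<lfloor>q / 2\<rfloor>)"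
| "floor_half PInf = PInf"

definition integer_weight :: "qinf \<Rightarrow> bool" where
  "integer_weight x \<longleftrightarrow> x = PInf \<or> (\<exists>k::int. x = Fin (of_int k))"

definition even_weight :: "qinf \<Rightarrow> bool" where
  "even_weight x \<longleftrightarrow> x = PInf \<or> (\<exists>k::int. even k \<and> x = Fin (of_int k))"

text \<open>A graph \<open>(N, w)\<close> is given by its weight function, which is taken to be extensional on
  \<open>N \<times> N\<close> so that equality of weight functions in HOL is equality of graphs.\<close>

type_synonym 'a wgraph = "'a \<times> 'a \<Rightarrow> qinf"

definition graph :: "'a set \<Rightarrow> 'a wgraph \<Rightarrow> bool" where
  "graph N w \<longleftrightarrow> finite N \<and> w \<in> extensional (N \<times> N)"

definition arc :: "'a set \<Rightarrow> 'a wgraph \<Rightarrow> 'a \<Rightarrow> 'a \<Rightarrow> bool" where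
  "arc N w a b \<longleftrightarrow> a \<in> N \<and> b \<in> N \<and> w (a, b) < PInf"

definition path :: "'a set \<Rightarrow> 'a wgraph \<Rightarrow> 'a list \<Rightarrow> bool" where
  "path N w p \<longleftrightarrow> p \<noteq> [] \<and> set p \<subseteq> N \<and> successively (arc N w) p"

definition path_weight :: "'a wgraph \<Rightarrow> 'a list \<Rightarrow> qinf" where
  "path_weight w p = (\<Sum>e\<leftarrow>zip p (tl p). w e)"

definition cycle :: "'a set \<Rightarrow> 'a wgraph \<Rightarrow> 'a list \<Rightarrow> bool" where
  "cycle N w p \<longleftrightarrow> path N w p \<and> hd p = last p"

definition consistent_graph :: "'a set \<Rightarrow> 'a wgraph \<Rightarrow> bool" where
  "consistent_graph N w \<longleftrightarrow> graph N w \<and> \<not> (\<exists>p. cycle N w p \<and> path_weight w p < 0)"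

definition graph_le :: "'a set \<Rightarrow> 'a wgraph \<Rightarrow> 'a wgraph \<Rightarrow> bool" where
  "graph_le N w\<^sub>1 w\<^sub>2 \<longleftrightarrow> (\<forall>a\<in>N. \<forall>b\<in>N. w\<^sub>1 (a, b) \<le> w\<^sub>2 (a, b))"

definition closed_graph :: "'a set \<Rightarrow> 'a wgraph \<Rightarrow> bool" where
  "closed_graph N w \<longleftrightarrow> consistent_graph N w \<and> (\<forall>a\<in>N. w (a, a) = 0) \<and>
     (\<forall>a\<in>N. \<forall>b\<in>N. \<forall>c\<in>N. w (a, b) \<le> w (a, c) + w (c, b))"

definition nodes :: "nat \<Rightarrow> nat set" where
  "nodes n = {..<2 * n}"

definition bar :: "nat \<Rightarrow> nat" where
  "bar i = (if even i then i + 1 else i - 1)"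

definition octagonal_graph :: "nat \<Rightarrow> nat wgraph \<Rightarrow> bool" where
  "octagonal_graph n w \<longleftrightarrow> consistent_graph (nodes n) w \<and>
     (\<forall>i\<in>nodes n. \<forall>j\<in>nodes n. w (i, j) = w (bar j, bar i))"

definition integer_octagonal_graph :: "nat \<Rightarrow> nat wgraph \<Rightarrow> bool" where
  "integer_octagonal_graph n w \<longleftrightarrow> octagonal_graph n w \<and>
     (\<forall>i\<in>nodes n. \<forall>j\<in>nodes n. integer_weight (w (i, j)))"

definition strongly_closed :: "nat \<Rightarrow> nat wgraph \<Rightarrow> bool" where
  "strongly_closed n w \<longleftrightarrow> octagonal_graph n w \<and> closed_graph (nodes n) w \<and>
     (\<forall>i\<in>nodes n. \<forall>j\<in>nodes n. w (i, j) + w (i, j) \<le> w (i, bar i) + w (bar j, j))"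

definition tightly_closed :: "nat \<Rightarrow> nat wgraph \<Rightarrow> bool" where
  "tightly_closed n w \<longleftrightarrow> strongly_closed n w \<and> integer_octagonal_graph n w \<and>
     (\<forall>i\<in>nodes n. even_weight (w (i, bar i)))"

text \<open>Octagonal graphs with an added bottom element, represented by \<^term>\<open>None\<close>.\<close>

definition octagonal_lattice :: "nat \<Rightarrow> nat wgraph option gorder" where
  "octagonal_lattice n =
     \<lparr>carrier = insert None (Some ` {w. octagonal_graph n w}),
      eq = (=),
      le = (\<lambda>x y. case x of None \<Rightarrow> True
             | Some w\<^sub>1 \<Rightarrow> (case y of None \<Rightarrow> False | Some w\<^sub>2 \<Rightarrow> graph_le (nodes n) w\<^sub>1 w\<^sub>2))\<rparr>"

definition T_closure :: "nat \<Rightarrow> nat wgraph \<Rightarrow> nat wgraph option" where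
  "T_closure n w =
     \<Squnion>\<^bsub>octagonal_lattice n\<^esub>(Some ` {w'. tightly_closed n w' \<and> graph_le (nodes n) w' w})"

definition tight_weight :: "nat \<Rightarrow> nat wgraph \<Rightarrow> nat wgraph" where
  "tight_weight n w = restrict
     (\<lambda>(i, j). min (w (i, j)) (floor_half (w (i, bar i)) + floor_half (w (bar j, j))))
     (nodes n \<times> nodes n)"

text \<open>The remaining facts show that the supremum in the definition of \<^const>\<open>T_closure\<close> always
  exists and is unique, so that its value does not depend on the choice operator used there.\<close>

lemma graph_ext:
  assumes "graph N u" "graph N v" "\<And>a b. a \<in> N \<Longrightarrow> b \<in> N \<Longrightarrow> u (a, b) = v (a, b)"
  shows "u = v"
  using assms unfolding graph_def by (intro extensionalityI[of u "N \<times> N" v]) auto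

lemma octagonal_graph_le_antisym:
  assumes "octagonal_graph n u" "octagonal_graph n v"
    "graph_le (nodes n) u v" "graph_le (nodes n) v u"
  shows "u = v"
proof (rule graph_ext[of "nodes n"])
  show "graph (nodes n) u" "graph (nodes n) v"
    using assms(1,2) by (simp_all add: octagonal_graph_def consistent_graph_def)
  show "u (a, b) = v (a, b)" if "a \<in> nodes n" "b \<in> nodes n" for a b
    using assms(3,4) that by (simp add: graph_le_def order_antisym)
qed

lemma octagonal_lattice_partial_order: "partial_order (octagonal_lattice n)"
proof unfold_locales
  fix x y z
  show "x .=\<^bsub>octagonal_lattice n\<^esub> y" if "x \<in> carrier (octagonal_lattice n)"
    "y \<in> carrier (octagonal_lattice n)" "x \<sqsubseteq>\<^bsub>octagonal_lattice n\<^esub> y" "y \<sqsubseteq>\<^bsub>octagonal_lattice n\<^esub> x"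
    using that
    by (auto simp: octagonal_lattice_def intro: octagonal_graph_le_antisym)
  show "x \<sqsubseteq>\<^bsub>octagonal_lattice n\<^esub> z"
    if "x \<sqsubseteq>\<^bsub>octagonal_lattice n\<^esub> y" "y \<sqsubseteq>\<^bsub>octagonal_lattice n\<^esub> z"
    using that
    by (auto simp: octagonal_lattice_def graph_le_def split: option.splits) (meson order_trans)
qed (auto simp: octagonal_lattice_def graph_le_def)

lemma path_weight_mono:
  assumes "graph_le N u v" "path N v p"
  shows "path N u p \<and> path_weight u p \<le> path_weight v p"
  using assms(2)
proof (induction p rule: induct_list012)
  case (3 a b p)
  then have "path N v (b # p)" "arc N v a b" by (auto simp: path_def)
  with 3 have *: "path N u (b # p)" "path_weight u (b # p) \<le> path_weight v (b # p)" by auto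
  moreover have "u (a, b) \<le> v (a, b)" "arc N u a b"
    using assms(1) \<open>arc N v a b\<close> by (auto simp: graph_le_def arc_def intro: le_less_trans)
  ultimately show ?case by (auto simp: path_def path_weight_def arc_def intro: add_mono)
qed (auto simp: path_def path_weight_def)

lemma consistent_graph_mono:
  assumes "consistent_graph N u" "graph N v" "graph_le N u v"
  shows "consistent_graph N v"
  using assms path_weight_mono[OF assms(3)]
  unfolding consistent_graph_def cycle_def by (meson le_less_trans)

lemma integer_weight_lub:
  assumes "\<And>x. x \<in> X \<Longrightarrow> integer_weight x" "X \<noteq> {}"
  shows "\<exists>m. (\<forall>x\<in>X. x \<le> m) \<and> (\<forall>y. (\<forall>x\<in>X. x \<le> y) \<longrightarrow> m \<le> y)"
proof (cases "\<exists>b. \<forall>x\<in>X. x \<le> Fin b")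
  case True
  then obtain b where b: "\<And>x. x \<in> X \<Longrightarrow> x \<le> Fin b" by auto
  obtain x\<^sub>0 where "x\<^sub>0 \<in> X" using assms by auto
  define K where "K = {k::int. Fin (of_int k) \<in> X}"
  have X: "\<exists>k\<in>K. x = Fin (of_int k)" if "x \<in> X" for x
    using assms(1)[OF that] b[OF that] that by (auto simp: integer_weight_def K_def)
  obtain k\<^sub>0 where k\<^sub>0: "k\<^sub>0 \<in> K" using X \<open>x\<^sub>0 \<in> X\<close> by auto
  have ub: "k \<le> \<lfloor>b\<rfloor>" if "k \<in> K" for k
    using b[of "Fin (of_int k)"] that by (auto simp: K_def le_floor_iff)
  let ?A = "K \<inter> {k\<^sub>0..}"
  have fin: "finite ?A" by (rule finite_subset[of _ "{k\<^sub>0..\<lfloor>b\<rfloor>}"]) (use ub in auto)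
  have mem: "Max ?A \<in> ?A" using fin k\<^sub>0 by (intro Max_in) auto
  have le: "k \<le> Max ?A" if "k \<in> K" for k
  proof (cases "k\<^sub>0 \<le> k")
    case True
    then show ?thesis using fin that by (intro Max_ge) auto
  next
    case False
    then show ?thesis using mem by auto
  qed
  show ?thesis
  proof (intro exI[of _ "Fin (of_int (Max ?A))"] conjI ballI allI impI)
    fix x assume "x \<in> X"
    then show "x \<le> Fin (of_int (Max ?A))" using X le by fastforce
  next
    fix y assume "\<forall>x\<in>X. x \<le> y"
    then show "Fin (of_int (Max ?A)) \<le> y" using mem by (auto simp: K_def)
  qed
next
  case False
  have "PInf \<le> y" if "\<forall>x\<in>X. x \<le> y" for y
    using False that by (cases y) auto
  then show ?thesis by (intro exI[of _ PInf]) auto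
qed

lemma bar_in_nodes [simp]: "bar i \<in> nodes n \<longleftrightarrow> i \<in> nodes n"
  unfolding nodes_def bar_def lessThan_iff by presburger

lemma T_closure_exists:
  "\<exists>x. is_lub (octagonal_lattice n) x
     (Some ` {w'. tightly_closed n w' \<and> graph_le (nodes n) w' w})"
proof -
  define S where "S = {w'. tightly_closed n w' \<and> graph_le (nodes n) w' w}"
  let ?L = "octagonal_lattice n" and ?N = "nodes n"
  have oct: "octagonal_graph n v" if "v \<in> S" for v
    using that by (auto simp: S_def tightly_closed_def strongly_closed_def)
  have "\<exists>x. is_lub ?L x (Some ` S)"
  proof (cases "S = {}")
    case True
    then show ?thesis
      by (intro exI[of _ None]) (auto simp: least_def Upper_def octagonal_lattice_def)
  next
    case False
    then obtain v\<^sub>0 where v\<^sub>0: "v\<^sub>0 \<in> S" by auto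
    define X where "X a b = (\<lambda>v. v (a, b)) ` S" for a b
    have "\<exists>m. (\<forall>x\<in>X a b. x \<le> m) \<and> (\<forall>y. (\<forall>x\<in>X a b. x \<le> y) \<longrightarrow> m \<le> y)"
      if "a \<in> ?N" "b \<in> ?N" for a b
      by (rule integer_weight_lub)
        (use that False in \<open>auto simp: X_def S_def tightly_closed_def integer_octagonal_graph_def\<close>)
    then obtain m where m: "\<And>a b. a \<in> ?N \<Longrightarrow> b \<in> ?N \<Longrightarrow>
        (\<forall>x\<in>X a b. x \<le> m a b) \<and> (\<forall>y. (\<forall>x\<in>X a b. x \<le> y) \<longrightarrow> m a b \<le> y)"
      by metis
    define M where "M = restrict (\<lambda>(a, b). m a b) (?N \<times> ?N)"
    have M: "M (a, b) = m a b" if "a \<in> ?N" "b \<in> ?N" for a b using that by (simp add: M_def)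
    have up: "graph_le ?N v M" if "v \<in> S" for v
      using that m M by (auto simp: graph_le_def X_def)
    have lst: "graph_le ?N M u" if "\<And>v. v \<in> S \<Longrightarrow> graph_le ?N v u" for u
      using that m M by (auto simp: graph_le_def X_def)
    have "graph ?N M" by (auto simp: graph_def M_def nodes_def)
    moreover have "consistent_graph ?N v\<^sub>0" using oct[OF v\<^sub>0] by (simp add: octagonal_graph_def)
    ultimately have "consistent_graph ?N M"
      using up[OF v\<^sub>0] consistent_graph_mono by blast
    moreover have "M (i, j) = M (bar j, bar i)" if ij: "i \<in> ?N" "j \<in> ?N" for i j
    proof -
      have "X i j = X (bar j) (bar i)"
        unfolding X_def by (rule image_cong) (use oct ij octagonal_graph_def in blast)+
      then show ?thesis using m[of i j] m[of "bar j" "bar i"] M ij by (auto intro!: antisym)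
    qed
    ultimately have "octagonal_graph n M" unfolding octagonal_graph_def by blast
    then have "is_lub ?L (Some M) (Some ` S)"
      using up lst v\<^sub>0 oct
      by (auto simp: least_def Upper_def octagonal_lattice_def split: option.splits)
    then show ?thesis ..
  qed
  then show ?thesis by (simp add: S_def)
qed

lemma T_closure_eq_iff:
  "T_closure n w = x \<longleftrightarrow> is_lub (octagonal_lattice n) x
     (Some ` {w'. tightly_closed n w' \<and> graph_le (nodes n) w' w})"
proof -
  interpret partial_order "octagonal_lattice n" by (rule octagonal_lattice_partial_order)
  show ?thesis
    unfolding T_closure_def Lattice.sup_def
    using someI_ex[OF T_closure_exists[of n w]] least_unique by blast
qed

end

theory Submission
  imports Defs
begin

text \<open>
  Write \<open>h i = \<lfloor>w (i, bar i) / 2\<rfloor>\<close>, so that \<open>w\<^sub>T (i, j) = min (w (i, j)) (h i + h (bar j))\<close> and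
  \<open>w\<^sub>T (i, bar i) = 2 h i\<close>.  Closedness and coherence of \<open>w\<close> give
  \<open>w (a, bar a) \<le> 2 w (a, c) + w (c, bar c)\<close>, hence \<open>h a \<le> w (a, c) + h c\<close> as \<open>w (a, c)\<close> is
  an integer; consistency of \<open>w\<^sub>T\<close> at the loop on \<open>c\<close> gives \<open>0 \<le> h c + h (bar c)\<close>.  These two
  inequalities yield the triangle inequality for \<open>w\<^sub>T\<close>, which is therefore tightly closed.
  Conversely, if \<open>w'\<close> is tightly closed and below \<open>w\<close>, then \<open>w' (i, bar i)\<close> is an even number below
  \<open>w (i, bar i)\<close>, hence at most \<open>2 h i\<close>, and strong closure puts \<open>w'\<close> below \<open>w\<^sub>T\<close>.  So \<open>w\<^sub>T\<close> is
  the greatest element of the set whose supremum is the tight closure.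
\<close>

lemma floor_half_double_le: "floor_half x + floor_half x \<le> x"
proof (cases x)
  case (Fin q)
  have "of_int \<lfloor>q / 2\<rfloor> \<le> q / 2" by (rule of_int_floor_le)
  then show ?thesis using Fin by simp
qed simp

lemma floor_half_mono: "x \<le> y \<Longrightarrow> floor_half x \<le> floor_half y"
  by (cases x; cases y) (auto intro: floor_mono divide_right_mono)

text \<open>Halving turns \<open>x + x\<close> into the integer \<open>x\<close>, which the floor
  lets through unchanged. This is how integrality of the weights enters
  \<open>floor_half_bar_le\<close>.\<close>

lemma floor_half_add_double:
  assumes "integer_weight x"
  shows "floor_half (x + x + y) = x + floor_half y"
proof (cases "x = PInf \<or> y = PInf")
  case True
  then show ?thesis by (cases x; cases y) auto
next
  case False
  then obtain k :: int and q where "x = Fin (of_int k)" "y = Fin q"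
    using assms by (cases y) (auto simp: integer_weight_def)
  moreover have "(of_int k + of_int k + q) / 2 = q / 2 + of_int k" by (simp add: field_simps)
  ultimately show ?thesis by (simp only: plus_qinf.simps floor_half.simps floor_add_int[symmetric])
      (simp add: add.commute)
qed

lemma floor_half_even_double:
  assumes "even_weight x"
  shows "floor_half x + floor_half x = x"
  using assms by (auto simp: even_weight_def elim!: evenE)

lemma double_le_double_iff: "x + x \<le> y + y \<longleftrightarrow> x \<le> y" for x y :: qinf
  by (cases x; cases y) auto

lemma integer_weight_floor_half [simp]: "integer_weight (floor_half x)"
  by (cases x) (auto simp: integer_weight_def)

lemma integer_weight_add:
  "integer_weight x \<Longrightarrow> integer_weight y \<Longrightarrow> integer_weight (x + y)"
  unfolding integer_weight_def by (metis of_int_add plus_qinf.simps)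

lemma even_weight_double: "integer_weight x \<Longrightarrow> even_weight (x + x)"
  unfolding even_weight_def integer_weight_def
  by (metis even_add of_int_add plus_qinf.simps(1,3))

lemma bar_bar [simp]: "bar (bar i) = i"
  by (auto simp: bar_def)

text \<open>A negative \<open>w (a, a)\<close> is finite, so \<open>[a, a]\<close> would be a cycle
  of that weight.\<close>

lemma loop_nonneg:
  assumes "consistent_graph N w" "a \<in> N"
  shows "0 \<le> w (a, a)"
proof (rule ccontr)
  assume neg: "\<not> 0 \<le> w (a, a)"
  then have "w (a, a) < PInf" by (cases "w (a, a)") (auto simp: less_qinf_def)
  then have "cycle N w [a, a]" using assms(2) by (auto simp: cycle_def path_def arc_def)
  moreover have "path_weight w [a, a] < 0" using neg by (simp add: path_weight_def)
  ultimately show False using assms(1) by (auto simp: consistent_graph_def)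
qed

lemma tight_weight_apply:
  assumes "i \<in> nodes n" "j \<in> nodes n"
  shows "tight_weight n w (i, j) =
    min (w (i, j)) (floor_half (w (i, bar i)) + floor_half (w (bar j, j)))"
  using assms by (simp add: tight_weight_def)

lemma tight_weight_le: "graph_le (nodes n) (tight_weight n w) w"
  by (simp add: graph_le_def tight_weight_apply)

lemma tight_weight_bar:
  assumes "i \<in> nodes n"
  shows "tight_weight n w (i, bar i) = floor_half (w (i, bar i)) + floor_half (w (i, bar i))"
  using assms floor_half_double_le by (simp add: tight_weight_apply min_absorb2)

text \<open>The route \<open>a\<close>, \<open>c\<close>, \<open>bar c\<close>, \<open>bar a\<close>
  bounds \<open>w (a, bar a)\<close>. By coherence its last step weighs as much as its first, so
  halving leaves a single \<open>w (a, c)\<close>.\<close>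

lemma floor_half_bar_le:
  assumes "integer_octagonal_graph n w" "closed_graph (nodes n) w"
    and ac: "a \<in> nodes n" "c \<in> nodes n"
  shows "floor_half (w (a, bar a)) \<le> w (a, c) + floor_half (w (c, bar c))"
proof -
  have tri: "w (x, y) \<le> w (x, z) + w (z, y)"
    if "x \<in> nodes n" "y \<in> nodes n" "z \<in> nodes n" for x y z
    using assms(2) that by (auto simp: closed_graph_def)
  have int: "integer_weight (w (a, c))" and coh: "w (bar c, bar a) = w (a, c)"
    using assms(1) ac unfolding integer_octagonal_graph_def octagonal_graph_def by metis+
  have "w (a, bar a) \<le> w (a, c) + w (c, bar a)" using ac by (simp add: tri)
  also have "\<dots> \<le> w (a, c) + (w (c, bar c) + w (bar c, bar a))"
    using ac by (intro add_left_mono tri) auto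
  also have "\<dots> = w (a, c) + w (a, c) + w (c, bar c)" by (simp add: coh ac_simps)
  finally show ?thesis using floor_half_add_double[OF int] floor_half_mono by metis
qed

lemma tight_weight_triangle:
  assumes "integer_octagonal_graph n w" "closed_graph (nodes n) w"
    and "consistent_graph (nodes n) (tight_weight n w)"
    and abc: "a \<in> nodes n" "b \<in> nodes n" "c \<in> nodes n"
  shows "tight_weight n w (a, b) \<le> tight_weight n w (a, c) + tight_weight n w (c, b)"
proof -
  define h where "h i = floor_half (w (i, bar i))" for i
  have T: "tight_weight n w (i, j) = min (w (i, j)) (h i + h (bar j))"
    if "i \<in> nodes n" "j \<in> nodes n" for i j
    using that by (simp add: tight_weight_apply h_def)
  have tri: "w (a, b) \<le> w (a, c) + w (c, b)"
    using assms(2) abc by (auto simp: closed_graph_def)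
  have left: "h a \<le> w (a, c) + h c"
    unfolding h_def using assms(1,2) abc by (intro floor_half_bar_le)
  \<comment> \<open>Coherence mirrors the pair \<open>(c, b)\<close>, so \<open>right\<close> is the
    same inequality as \<open>left\<close>, now taken from \<open>bar b\<close> to
    \<open>bar c\<close>.\<close>
  have "w (bar b, bar c) = w (c, b)"
    using assms(1) abc unfolding integer_octagonal_graph_def octagonal_graph_def by metis
  then have right: "h (bar b) \<le> w (c, b) + h (bar c)"
    unfolding h_def using floor_half_bar_le[OF assms(1,2), of "bar b" "bar c"] abc by simp
  \<comment> \<open>The sum is one of the two terms of the minimum defining
    \<open>tight_weight n w (c, c)\<close>.\<close>
  have loop: "0 \<le> h c + h (bar c)"
    using loop_nonneg[OF assms(3) abc(3)] abc by (simp add: T)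
  \<comment> \<open>Each of the two minima on the right is attained by one of its terms. The mixed
    cases need \<open>left\<close> or \<open>right\<close>, the last one
    \<open>loop\<close>.\<close>
  consider "tight_weight n w (a, c) = w (a, c)" "tight_weight n w (c, b) = w (c, b)"
    | "tight_weight n w (a, c) = w (a, c)" "tight_weight n w (c, b) = h c + h (bar b)"
    | "tight_weight n w (a, c) = h a + h (bar c)" "tight_weight n w (c, b) = w (c, b)"
    | "tight_weight n w (a, c) = h a + h (bar c)" "tight_weight n w (c, b) = h c + h (bar b)"
    using T[OF abc(1,3)] T[OF abc(3,2)] unfolding min_def by presburger
  then show ?thesis
  proof cases
    case 1
    then show ?thesis using tri abc by (simp add: T min.coboundedI1)
  next
    case 2
    have "h a + h (bar b) \<le> w (a, c) + (h c + h (bar b))"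
      using add_right_mono[OF left, of "h (bar b)"] by (simp add: ac_simps)
    then show ?thesis using 2 abc by (simp add: T min.coboundedI2)
  next
    case 3
    have "h a + h (bar b) \<le> h a + h (bar c) + w (c, b)"
      using add_left_mono[OF right, of "h a"] by (simp add: ac_simps)
    then show ?thesis using 3 abc by (simp add: T min.coboundedI2)
  next
    case 4
    have "h a + h (bar b) \<le> h a + h (bar c) + (h c + h (bar b))"
      using add_left_mono[OF loop, of "h a + h (bar b)"] by (simp add: ac_simps)
    then show ?thesis using 4 abc by (simp add: T min.coboundedI2)
  qed
qed

lemma tightly_closed_tight_weight:
  assumes "integer_octagonal_graph n w" "closed_graph (nodes n) w"
    and oct: "octagonal_graph n (tight_weight n w)"
  shows "tightly_closed n (tight_weight n w)"
proof -
  let ?t = "tight_weight n w"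
  have con: "consistent_graph (nodes n) ?t" using oct by (simp add: octagonal_graph_def)
  have "?t (a, a) = 0" if "a \<in> nodes n" for a
  proof (rule antisym)
    show "?t (a, a) \<le> 0"
      using assms(2) that by (simp add: tight_weight_apply closed_graph_def)
    show "0 \<le> ?t (a, a)" using con that by (rule loop_nonneg)
  qed
  then have "closed_graph (nodes n) ?t"
    using con tight_weight_triangle[OF assms(1,2) con] by (simp add: closed_graph_def)
  moreover have "?t (i, j) + ?t (i, j) \<le> ?t (i, bar i) + ?t (bar j, j)"
    if "i \<in> nodes n" "j \<in> nodes n" for i j
  proof -
    let ?s = "floor_half (w (i, bar i)) + floor_half (w (bar j, j))"
    have "?t (i, j) \<le> ?s" using that by (simp add: tight_weight_apply)
    then have "?t (i, j) + ?t (i, j) \<le> ?s + ?s" by (intro add_mono)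
    also have "\<dots> = ?t (i, bar i) + ?t (bar j, j)"
      using that tight_weight_bar[of i n w] tight_weight_bar[of "bar j" n w] by (simp add: ac_simps)
    finally show ?thesis .
  qed
  moreover have "integer_weight (?t (i, j))" if "i \<in> nodes n" "j \<in> nodes n" for i j
    using assms(1) that
    by (simp add: tight_weight_apply integer_octagonal_graph_def min_def integer_weight_add)
  moreover have "even_weight (?t (i, bar i))" if "i \<in> nodes n" for i
    using that by (simp add: tight_weight_bar even_weight_double)
  ultimately show ?thesis
    using oct by (simp add: tightly_closed_def strongly_closed_def integer_octagonal_graph_def)
qed

text \<open>Evenness makes \<open>floor_half\<close> exact on the entries
  \<open>v (i, bar i)\<close>, so the doubled inequality of strong closure can be halved without
  loss before passing from \<open>v\<close> to \<open>w\<close>.\<close>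

lemma tightly_closed_le_tight_weight:
  assumes "tightly_closed n v" "graph_le (nodes n) v w"
  shows "graph_le (nodes n) v (tight_weight n w)"
  unfolding graph_le_def
proof (intro ballI)
  fix i j assume ij: "i \<in> nodes n" "j \<in> nodes n"
  have ev: "even_weight (v (k, bar k))" if "k \<in> nodes n" for k
    using assms(1) that by (simp add: tightly_closed_def)
  have le: "v (k, l) \<le> w (k, l)" if "k \<in> nodes n" "l \<in> nodes n" for k l
    using assms(2) that by (simp add: graph_le_def)
  let ?p = "floor_half (v (i, bar i))" and ?q = "floor_half (v (bar j, j))"
  have "v (i, j) + v (i, j) \<le> v (i, bar i) + v (bar j, j)"
    using assms(1) ij by (simp add: tightly_closed_def strongly_closed_def)
  also have "\<dots> = (?p + ?q) + (?p + ?q)"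
    using floor_half_even_double[OF ev[of i]] floor_half_even_double[OF ev[of "bar j"]] ij
    by (metis add.assoc add.commute bar_bar bar_in_nodes)
  finally have "v (i, j) \<le> ?p + ?q" by (simp only: double_le_double_iff)
  also have "\<dots> \<le> floor_half (w (i, bar i)) + floor_half (w (bar j, j))"
    using ij by (intro add_mono floor_half_mono le) auto
  finally show "v (i, j) \<le> tight_weight n w (i, j)"
    using ij le by (simp add: tight_weight_apply)
qed

theorem theorem2:
  fixes n :: nat and w :: "nat wgraph"
  assumes "n \<ge> 1"
    and "integer_octagonal_graph n w"
    and "closed_graph (nodes n) w"
    and "octagonal_graph n (tight_weight n w)"
  shows "Some (tight_weight n w) = T_closure n w"
proof -
  let ?S = "{v. tightly_closed n v \<and> graph_le (nodes n) v w}"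
  have "tight_weight n w \<in> ?S"
    using tightly_closed_tight_weight[OF assms(2-4)] tight_weight_le by simp
  moreover have "octagonal_graph n v" if "v \<in> ?S" for v
    using that by (simp add: tightly_closed_def strongly_closed_def)
  \<comment> \<open>An upper bound that belongs to the set lies below every other upper
    bound.\<close>
  ultimately have "is_lub (octagonal_lattice n) (Some (tight_weight n w)) (Some ` ?S)"
    using tightly_closed_le_tight_weight assms(4)
    by (auto simp: least_def Upper_def octagonal_lattice_def)
  then show ?thesis using T_closure_eq_iff by metis
qed

end
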